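(* Let $A=\omega_1^*+\omega_1$ (a copy of the reverse of $\omega_1$ followed by a copy of $\omega_1$). Then $A^{\omega}$ does not admit a parity-reversing automorphism.
   Context: $A^\omega$: infinite sequences of elements of $A$ ordered lexicographically; $au$ prepends $a$ to $u$. $u\sim_2 v$ iff there exist finite sequences $r,s$ with $|r|\equiv|s|\pmod 2$ and $u'\in A^\omega$ with $u=ru'$, $v=su'$. A parity-reversing automorphism of $A^\omega$ is an order automorphism $f$ with $f(u)\sim_2 au$ for all $u\in A^\omega$, $a\in A$. *)

theory Defs
  imports "HOL-Library.Stream"
begin

text \<open>
  Linear orders are reflexive relations \<open>R\<close> with carrier \<^term>\<open>Field R\<close>. Cardinals in the
  library are initial well-orders, so the cardinal successor of \<^term>\<open>natLeq\<close>
  is a well-order of type \<open>\<omega>\<^sub>1\<close>.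
\<close>

definition omega1 :: "nat set rel" where
  "omega1 = cardSuc natLeq"

definition order_sum :: "'a rel \<Rightarrow> 'b rel \<Rightarrow> ('a + 'b) rel" where
  "order_sum R S =
     {(Inl x, Inl y) | x y. (x, y) \<in> R} \<union>
     {(Inr x, Inr y) | x y. (x, y) \<in> S} \<union>
     {(Inl x, Inr y) | x y. x \<in> Field R \<and> y \<in> Field S}"

definition lex_omega :: "'a rel \<Rightarrow> 'a stream rel" where
  "lex_omega R =
     {(u, v). u \<in> streams (Field R) \<and> v \<in> streams (Field R) \<and>
        (u = v \<or> (\<exists>n. (\<forall>i<n. u !! i = v !! i) \<and> u !! n \<noteq> v !! n \<and> (u !! n, v !! n) \<in> R))}"

lemma Field_lex_omega: "Field (lex_omega R) = streams (Field R)"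
  by (auto simp: lex_omega_def Field_def)

definition sim2 :: "'a set \<Rightarrow> 'a stream \<Rightarrow> 'a stream \<Rightarrow> bool" where
  "sim2 X u v \<longleftrightarrow>
     (\<exists>r \<in> lists X. \<exists>s \<in> lists X. \<exists>u' \<in> streams X.
        length r mod 2 = length s mod 2 \<and> u = r @- u' \<and> v = s @- u')"

definition order_automorphism :: "'a rel \<Rightarrow> ('a \<Rightarrow> 'a) \<Rightarrow> bool" where
  "order_automorphism R f \<longleftrightarrow>
     bij_betw f (Field R) (Field R) \<and>
     (\<forall>x \<in> Field R. \<forall>y \<in> Field R. (x, y) \<in> R \<longleftrightarrow> (f x, f y) \<in> R)"

definition parity_reversing_automorphism :: "'a rel \<Rightarrow> ('a stream \<Rightarrow> 'a stream) \<Rightarrow> bool" where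
  "parity_reversing_automorphism R f \<longleftrightarrow>
     order_automorphism (lex_omega R) f \<and>
     (\<forall>u \<in> streams (Field R). \<forall>a \<in> Field R. sim2 (Field R) (f u) (a ## u))"

end

theory Submission imports Defs begin

text \<open>
  Every order automorphism \<open>f\<close> of \<open>A\<^sup>\<omega>\<close> fixes a point with pairwise distinct letters, and such a
  point \<open>u\<close> is not equivalent to \<open>au\<close>. Write \<open>I\<^sub>r\<close> for the set of sequences with prefix \<open>r\<close>. If \<open>f\<close>
  fixes the cut above \<open>I\<^sub>r\<close>, then the cuts below \<open>I\<^bsub>r\<gamma>\<^esub>\<close>, with \<open>\<gamma>\<close> in the final copy of \<open>\<omega>\<^sub>1\<close>, form
  a continuous increasing \<open>\<omega>\<^sub>1\<close>-sequence converging to it, so \<open>f\<close> fixes club many of them. Dually,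
  if \<open>f\<close> fixes the cut below \<open>I\<^sub>r\<close>, it fixes the cut above \<open>I\<^bsub>r\<gamma>\<^esub>\<close> for club many \<open>\<gamma>\<close> in the
  initial copy of \<open>\<omega>\<^sub>1\<^sup>*\<close>. Alternating the two steps gives cuts that close in from both sides on
  one fixed point, and the clubs leave room to choose its letters distinct.
\<close>

section \<open>The order type \<open>\<omega>\<^sub>1\<close>\<close>

lemma Card_order_omega1: "Card_order omega1"
  unfolding omega1_def by (simp add: cardSuc_Card_order natLeq_Card_order)

lemma Well_order_omega1: "Well_order omega1"
  using Card_order_omega1 by (rule card_order_on_well_order_on)

lemma Cinfinite_omega1: "Cinfinite omega1"
  unfolding omega1_def by (rule Cinfinite_cardSuc[OF natLeq_Cinfinite])

lemma omega1_less_trans: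
  assumes "(x, y) \<in> omega1 - Id" and "(y, z) \<in> omega1"
  shows "(x, z) \<in> omega1 - Id"
proof -
  have "trans omega1" "antisym omega1"
    using Well_order_omega1 by (auto simp: order_on_defs)
  then show ?thesis
    using assms by (auto dest: transD antisymD)
qed

lemma omega1_not_less:
  assumes "x \<in> Field omega1" "y \<in> Field omega1" "(x, y) \<notin> omega1 - Id"
  shows "(y, x) \<in> omega1"
  using assms Well_order_omega1
  by (cases "x = y") (auto simp: order_on_defs total_on_def dest: refl_onD)

lemma omega1_no_max:
  assumes "x \<in> Field omega1"
  obtains y where "y \<in> Field omega1" "(x, y) \<in> omega1 - Id"
  using infinite_Card_order_limit[OF Card_order_omega1 _ assms] Cinfinite_omega1
  by (auto simp: cinfinite_def)

lemma omega1_countable_bounded: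
  includes cardinal_syntax
  fixes g :: "nat \<Rightarrow> nat set"
  assumes g: "\<And>n. g n \<in> Field omega1"
  obtains b where "b \<in> Field omega1" "\<And>n. (g n, b) \<in> omega1 - Id"
proof -
  have "|range g| \<le>o natLeq"
    using card_of_image[of g UNIV] card_of_nat ordLeq_ordIso_trans by blast
  moreover have "natLeq <o omega1"
    unfolding omega1_def by (rule cardSuc_greater[OF natLeq_Card_order])
  ultimately have less: "|range g| <o omega1"
    by (rule ordLeq_ordLess_trans)
  have "regularCard omega1"
    unfolding omega1_def by (rule infinite_cardSuc_regularCard)
      (use natLeq_Cinfinite in \<open>auto simp: cinfinite_def\<close>)
  then have "\<not> cofinal (range g) omega1"
    using less g not_ordLess_ordIso unfolding regularCard_def by blast
  then obtain a where a: "a \<in> Field omega1" "\<And>n. (a, g n) \<notin> omega1 - Id"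
    unfolding cofinal_def by blast
  \<comment> \<open>Failure of cofinality makes \<open>a\<close> only a weak upper bound; a larger
    \<open>b\<close> is a strict one.\<close>
  obtain b where b: "b \<in> Field omega1" "(a, b) \<in> omega1 - Id"
    using omega1_no_max[OF a(1)] .
  have "(g n, b) \<in> omega1 - Id" for n
  proof -
    have "(g n, a) \<in> omega1"
      using omega1_not_less[OF a(1) g a(2)] .
    then show ?thesis
      using b(2) Well_order_omega1
      by (auto simp: order_on_defs dest: transD antisymD)
  qed
  with b(1) show ?thesis using that by blast
qed

lemma omega1_bounded2:
  assumes "x \<in> Field omega1" "y \<in> Field omega1"
  obtains b where "b \<in> Field omega1" "(x, b) \<in> omega1 - Id" "(y, b) \<in> omega1 - Id"
proof -
  have "(case n of 0 \<Rightarrow> x | Suc _ \<Rightarrow> y) \<in> Field omega1" for n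
    using assms by (cases n) auto
  then obtain b where b: "b \<in> Field omega1" "\<And>n. (case n of 0 \<Rightarrow> x | Suc _ \<Rightarrow> y, b) \<in> omega1 - Id"
    using omega1_countable_bounded by blast
  show ?thesis
    using that b(1) b(2)[of 0] b(2)[of 1] by simp
qed

text \<open>The supremum \<open>l\<close> of the \<open>g n\<close> lies in the club of ordinals closed under (a monotone bound of) \<open>h\<close>.\<close>

lemma omega1_closure_point:
  assumes h: "\<And>x. x \<in> Field omega1 \<Longrightarrow> h x \<in> Field omega1" and c: "c \<in> Field omega1"
  shows "\<exists>l \<in> Field omega1. (c, l) \<in> omega1 - Id \<and> (\<exists>g :: nat \<Rightarrow> nat set.
    (\<forall>n. g n \<in> Field omega1 \<and> (g n, l) \<in> omega1 - Id \<and> (h (g n), g (Suc n)) \<in> omega1 - Id) \<and>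
    (\<forall>x. (x, l) \<in> omega1 - Id \<longrightarrow> (\<exists>n. (x, g n) \<in> omega1 - Id)))"
proof -
  have step: "\<exists>y. y \<in> Field omega1 \<and> (x, y) \<in> omega1 - Id \<and> (h x, y) \<in> omega1 - Id"
    if x: "x \<in> Field omega1" for x
    using omega1_bounded2[OF x h[OF x]] by metis
  \<comment> \<open>The sequence starts at \<open>c\<close>; each term exceeds both its predecessor
    and the predecessor's \<open>h\<close>-value.\<close>
  have "\<exists>g. \<forall>n. (g n \<in> Field omega1 \<and> (n = 0 \<longrightarrow> g n = c)) \<and>
      ((g n, g (Suc n)) \<in> omega1 - Id \<and> (h (g n), g (Suc n)) \<in> omega1 - Id)"
  proof (rule dependent_nat_choice)
    show "\<exists>x. x \<in> Field omega1 \<and> ((0::nat) = 0 \<longrightarrow> x = c)"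
      using c by blast
    show "\<exists>y. (y \<in> Field omega1 \<and> (Suc n = 0 \<longrightarrow> y = c)) \<and>
        ((x, y) \<in> omega1 - Id \<and> (h x, y) \<in> omega1 - Id)"
      if "x \<in> Field omega1 \<and> (n = 0 \<longrightarrow> x = c)" for x n
      using step that by blast
  qed
  then obtain g where "\<forall>n. (g n \<in> Field omega1 \<and> (n = 0 \<longrightarrow> g n = c)) \<and>
      ((g n, g (Suc n)) \<in> omega1 - Id \<and> (h (g n), g (Suc n)) \<in> omega1 - Id)" ..
  then have g: "\<And>n. g n \<in> Field omega1"
    "\<And>n. (g n, g (Suc n)) \<in> omega1 - Id" "\<And>n. (h (g n), g (Suc n)) \<in> omega1 - Id" "g 0 = c"
    by simp_all
  define B where "B = {b \<in> Field omega1. \<forall>n. (g n, b) \<in> omega1 - Id}"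
  obtain b where "b \<in> Field omega1" "\<And>n. (g n, b) \<in> omega1 - Id"
    using omega1_countable_bounded[of g] g(1) by metis
  then have "b \<in> B"
    unfolding B_def by blast
  moreover have "wf (omega1 - Id)"
    using Well_order_omega1 by (simp add: well_order_on_def)
  ultimately obtain l where l: "l \<in> B" "\<And>x. (x, l) \<in> omega1 - Id \<Longrightarrow> x \<notin> B"
    by (metis wfE_min)
  \<comment> \<open>By minimality of \<open>l\<close>, such an \<open>x\<close> fails to exceed some
    \<open>g n\<close>, so the next term is strictly above it.\<close>
  have "\<exists>n. (x, g n) \<in> omega1 - Id" if x: "(x, l) \<in> omega1 - Id" for x
  proof -
    have xF: "x \<in> Field omega1"
      using x by (auto intro: FieldI1)
    then obtain n where "(g n, x) \<notin> omega1 - Id"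
      using l(2)[OF x] unfolding B_def by blast
    then have "(x, g n) \<in> omega1"
      using omega1_not_less[OF g(1) xF] by blast
    then have "(x, g (Suc n)) \<in> omega1 - Id"
      using g(2)[of n] Well_order_omega1
      by (auto simp: order_on_defs dest: transD antisymD)
    then show ?thesis ..
  qed
  moreover have "l \<in> Field omega1" and gl: "\<And>n. (g n, l) \<in> omega1 - Id"
    using l(1) unfolding B_def by auto
  moreover have "(c, l) \<in> omega1 - Id"
    using gl[of 0] g(4) by simp
  ultimately show ?thesis
    using g(1,3) by blast
qed

section \<open>Cuts of the lexicographic power\<close>

lemma lex_omega_converse: "lex_omega (R\<inverse>) = (lex_omega R)\<inverse>"
proof -
  have "(u, v) \<in> lex_omega (R\<inverse>) \<longleftrightarrow> (v, u) \<in> lex_omega R" for u v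
    unfolding lex_omega_def by (simp add: eq_commute conj_ac)
  then show ?thesis
    by auto
qed

lemma order_automorphism_converse:
  "order_automorphism (R\<inverse>) f \<longleftrightarrow> order_automorphism R f"
  unfolding order_automorphism_def by auto

text \<open>The lower side of the cut below \<open>I_r\<close>. For \<open>R\<inverse>\<close> it
  becomes the upper side of the cut above \<open>I_r\<close>, so one notion covers both kinds of
  cut.\<close>

definition strictly_below :: "'a rel \<Rightarrow> 'a list \<Rightarrow> 'a stream set" where
  "strictly_below R r = {x \<in> streams (Field R).
     \<exists>i<length r. (\<forall>j<i. x !! j = r ! j) \<and> (x !! i, r ! i) \<in> R - Id}"

text \<open>For a bijection of \<open>X\<close> and \<open>D \<subseteq> X\<close> this says that
  \<open>f\<close> maps \<open>D\<close> onto itself; with \<open>D\<close> one side of a cut,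
  \<open>f\<close> fixes that cut.\<close>

definition invariant_on :: "'a set \<Rightarrow> ('a \<Rightarrow> 'a) \<Rightarrow> 'a set \<Rightarrow> bool" where
  "invariant_on X f D \<longleftrightarrow> (\<forall>x \<in> X. f x \<in> D \<longleftrightarrow> x \<in> D)"

lemma strictly_below_shift:
  assumes "x \<in> strictly_below R r" "r \<in> lists (Field R)" "w \<in> streams (Field R)"
  shows "(x, r @- w) \<in> lex_omega R"
proof -
  from assms(1) obtain i where i: "i < length r" "\<forall>j<i. x !! j = r ! j" "(x !! i, r ! i) \<in> R - Id"
    and x: "x \<in> streams (Field R)"
    unfolding strictly_below_def by blast
  have "\<exists>n. (\<forall>i<n. x !! i = (r @- w) !! i) \<and> x !! n \<noteq> (r @- w) !! n \<and> (x !! n, (r @- w) !! n) \<in> R"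
    using i by (intro exI[of _ i]) (auto simp: shift_snth_less)
  moreover have "r @- w \<in> streams (Field R)"
    using assms(2,3) by (simp add: shift_streams)
  ultimately show ?thesis
    using x unfolding lex_omega_def by blast
qed

text \<open>Let \<open>x\<close>, \<open>y\<close> first differ at \<open>n\<close> and
  \<open>y\<close>, \<open>r\<close> at \<open>m\<close>. At the smaller of the two positions
  \<open>x\<close> already drops below \<open>r\<close>.\<close>

lemma strictly_below_down_closed:
  assumes lin: "Linear_order R" and le: "(x, y) \<in> lex_omega R" and y: "y \<in> strictly_below R r"
  shows "x \<in> strictly_below R r"
proof (cases "x = y")
  case False
  with le obtain n where n: "\<forall>i<n. x !! i = y !! i" "(x !! n, y !! n) \<in> R - Id"
    and x: "x \<in> streams (Field R)"
    unfolding lex_omega_def by auto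
  from y obtain m where m: "m < length r" "\<forall>j<m. y !! j = r ! j" "(y !! m, r ! m) \<in> R - Id"
    unfolding strictly_below_def by blast
  have tr: "(a, c) \<in> R - Id" if "(a, b) \<in> R - Id" "(b, c) \<in> R - Id" for a b c
    using that lin by (auto simp: order_on_defs dest: transD antisymD)
  have "(x !! min n m, r ! min n m) \<in> R - Id"
    using n m tr[of "x !! n" "y !! n" "r ! n"] by (cases n m rule: linorder_cases) auto
  moreover have "\<forall>j<min n m. x !! j = r ! j"
    using n(1) m(2) by simp
  ultimately show ?thesis
    using x m(1) unfolding strictly_below_def by (auto intro!: exI[of _ "min n m"])
qed (use y in simp)

text \<open>A sequence not above \<open>I_r\<close> either has prefix \<open>r\<close>, and then its
  next letter decides, or leaves \<open>r\<close> downwards at its first difference.\<close>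

lemma strictly_below_snocI:
  assumes lin: "Linear_order R" and x: "x \<in> streams (Field R)" and r: "r \<in> lists (Field R)"
    and above: "x \<notin> strictly_below (R\<inverse>) r" and a: "(x !! length r, a) \<in> R - Id"
  shows "x \<in> strictly_below R (r @ [a])"
proof (cases "\<forall>j<length r. x !! j = r ! j")
  case True
  then show ?thesis
    using x a unfolding strictly_below_def
    by (auto intro!: exI[of _ "length r"] simp: nth_append)
next
  case False
  define i where "i = (LEAST j. j < length r \<and> x !! j \<noteq> r ! j)"
  have i: "i < length r \<and> x !! i \<noteq> r ! i"
    unfolding i_def by (rule LeastI_ex) (use False in auto)
  have agree: "\<forall>j<i. x !! j = r ! j"
    using i not_less_Least[of _ "\<lambda>j. j < length r \<and> x !! j \<noteq> r ! j"]
    unfolding i_def[symmetric] by force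
  have "x !! i \<in> Field R" "r ! i \<in> Field R"
    using x r i by (auto simp: streams_iff_snth)
  then have "(x !! i, r ! i) \<in> R - Id \<or> (x !! i, r ! i) \<in> R\<inverse> - Id"
    using i lin by (auto simp: order_on_defs total_on_def)
  moreover have "(x !! i, r ! i) \<notin> R\<inverse> - Id"
    using above x i agree unfolding strictly_below_def by auto
  ultimately show ?thesis
    using x i agree unfolding strictly_below_def
    by (auto intro!: exI[of _ i] simp: nth_append)
qed

section \<open>Linear orders ending in a copy of \<open>\<omega>\<^sub>1\<close>\<close>

text \<open>This isolates what one extension step needs, so that it serves both the order and its
  converse. \<open>e_final\<close> gives continuity: below \<open>e c\<close> lie only earlier
  values of \<open>e\<close> and elements below all its values.\<close>

locale omega1_ended =
  fixes R :: "'a rel" and e :: "nat set \<Rightarrow> 'a"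
  assumes lin: "Linear_order R"
    and e_Field: "c \<in> Field omega1 \<Longrightarrow> e c \<in> Field R"
    and e_strict: "(c, d) \<in> omega1 - Id \<Longrightarrow> (e c, e d) \<in> R - Id"
    and e_final: "(x, e c) \<in> R - Id \<Longrightarrow> c \<in> Field omega1 \<Longrightarrow>
      (\<exists>d. (d, c) \<in> omega1 - Id \<and> x = e d) \<or> (\<forall>d \<in> Field omega1. (x, e d) \<in> R - Id)"
    and e_cofinal: "x \<in> Field R \<Longrightarrow> \<exists>c \<in> Field omega1. (x, e c) \<in> R - Id"
begin

lemma strictly_below_snoc_mono:
  assumes "x \<in> strictly_below R (r @ [e c])" "(c, d) \<in> omega1 - Id"
  shows "x \<in> strictly_below R (r @ [e d])"
proof -
  from assms(1) obtain i where x: "x \<in> streams (Field R)" and i: "i \<le> length r"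
    "\<forall>j<i. x !! j = (r @ [e c]) ! j" "(x !! i, (r @ [e c]) ! i) \<in> R - Id"
    unfolding strictly_below_def by (auto simp: less_Suc_eq_le)
  have "\<forall>j<i. x !! j = (r @ [e d]) ! j"
    using i by (auto simp: nth_append)
  moreover have "(x !! i, (r @ [e d]) ! i) \<in> R - Id"
    using i(1,3) e_strict[OF assms(2)] lin
    by (cases "i = length r") (auto simp: nth_append order_on_defs dest: transD antisymD)
  ultimately show ?thesis
    using x i(1) unfolding strictly_below_def by (auto intro!: exI[of _ i])
qed

text \<open>Only position \<open>length r\<close> depends on the index. A letter below
  \<open>e l\<close> there is some \<open>e d\<close> with \<open>d\<close> before \<open>l\<close>,
  overtaken by a \<open>g n\<close>, or lies below every value of \<open>e\<close>.\<close>

lemma strictly_below_snoc_limit: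
  assumes x: "x \<in> strictly_below R (r @ [e l])" and l: "l \<in> Field omega1"
    and g: "\<And>n::nat. g n \<in> Field omega1"
    and lim: "\<And>c. (c, l) \<in> omega1 - Id \<Longrightarrow> \<exists>n. (c, g n) \<in> omega1 - Id"
  shows "\<exists>n. x \<in> strictly_below R (r @ [e (g n)])"
proof -
  from x obtain i where xs: "x \<in> streams (Field R)" and i: "i \<le> length r"
    "\<forall>j<i. x !! j = (r @ [e l]) ! j" "(x !! i, (r @ [e l]) ! i) \<in> R - Id"
    unfolding strictly_below_def by (auto simp: less_Suc_eq_le)
  have agree: "\<forall>j<i. x !! j = (r @ [e d]) ! j" for d
    using i by (auto simp: nth_append)
  have "\<exists>n. (x !! i, (r @ [e (g n)]) ! i) \<in> R - Id"
  proof (cases "i = length r")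
    case True
    then have "(x !! i, e l) \<in> R - Id"
      using i(3) by simp
    from e_final[OF this l] have "\<exists>n. (x !! i, e (g n)) \<in> R - Id"
      using lim e_strict g by metis
    then show ?thesis
      using True by simp
  qed (use i in \<open>simp add: nth_append\<close>)
  then show ?thesis
    using xs i(1) agree unfolding strictly_below_def
    by (auto simp: less_Suc_eq_le)
qed

lemma invariant_snoc:
  assumes f: "order_automorphism (lex_omega R) f" and r: "r \<in> lists (Field R)"
    and inv: "invariant_on (streams (Field R)) f (strictly_below (R\<inverse>) r)"
    and c: "c \<in> Field omega1"
  obtains l where "l \<in> Field omega1" "(c, l) \<in> omega1 - Id"
    "invariant_on (streams (Field R)) f (strictly_below R (r @ [e l]))"
proof -
  let ?X = "streams (Field R)"
  let ?D = "\<lambda>d. strictly_below R (r @ [e d])"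
  have bij: "bij_betw f ?X ?X"
    and mono: "\<And>x y. x \<in> ?X \<Longrightarrow> y \<in> ?X \<Longrightarrow> (x, y) \<in> lex_omega R \<longleftrightarrow> (f x, f y) \<in> lex_omega R"
    using f unfolding order_automorphism_def Field_lex_omega by auto
  \<comment> \<open>An arbitrary tail, turning each word \<open>r @ [e d]\<close> into a point
    \<open>p d\<close> of its interval.\<close>
  define w where "w = sconst (e c)"
  have w: "w \<in> ?X"
    using e_Field[OF c] unfolding w_def by (simp add: streams_iff_snth)
  define p where "p d = (r @ [e d]) @- w" for d
  have p: "p d \<in> ?X" if "d \<in> Field omega1" for d
    unfolding p_def using r e_Field[OF that] w by (intro shift_streams) auto
  have below_p: "(x, p d) \<in> lex_omega R" if "x \<in> ?D d" "d \<in> Field omega1" for x d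
    unfolding p_def using that r e_Field w by (intro strictly_below_shift) auto
  have p_above: "p d \<notin> strictly_below (R\<inverse>) r" for d
    unfolding strictly_below_def p_def by auto
  \<comment> \<open>Cofinality of \<open>e\<close> yields an index beyond the letter of
    \<open>x\<close> at position \<open>length r\<close>.\<close>
  have cof: "\<exists>d \<in> Field omega1. x \<in> ?D d"
    if "x \<in> ?X" "x \<notin> strictly_below (R\<inverse>) r" for x
    using e_cofinal[OF snth_in[OF that(1)]] strictly_below_snocI[OF lin that(1) r that(2)]
    by blast
  \<comment> \<open>Both the image and the preimage of \<open>p d\<close> are bounded, one for each
    direction of the invariance.\<close>
  have "\<exists>b \<in> Field omega1. f (p d) \<in> ?D b \<and> (\<forall>q \<in> ?X. f q = p d \<longrightarrow> q \<in> ?D b)"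
    if d: "d \<in> Field omega1" for d
  proof -
    obtain q where q: "q \<in> ?X" "f q = p d"
      using bij_betw_imp_surj_on[OF bij] p[OF d] by (metis imageE)
    have "f (p d) \<in> ?X"
      using bij p[OF d] by (simp add: bij_betwE)
    moreover have "f (p d) \<notin> strictly_below (R\<inverse>) r"
      using inv p[OF d] p_above unfolding invariant_on_def by blast
    ultimately obtain b1 where b1: "b1 \<in> Field omega1" "f (p d) \<in> ?D b1"
      using cof by blast
    have "q \<notin> strictly_below (R\<inverse>) r"
      using inv q p_above unfolding invariant_on_def by metis
    then obtain b2 where b2: "b2 \<in> Field omega1" "q \<in> ?D b2"
      using cof q(1) by blast
    obtain b where b: "b \<in> Field omega1" "(b1, b) \<in> omega1 - Id" "(b2, b) \<in> omega1 - Id"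
      using omega1_bounded2[OF b1(1) b2(1)] .
    have "f (p d) \<in> ?D b" "q \<in> ?D b"
      using strictly_below_snoc_mono b1(2) b2(2) b(2,3) by blast+
    moreover have "q' = q" if "q' \<in> ?X" "f q' = p d" for q'
      using inj_onD[OF bij_betw_imp_inj_on[OF bij]] that q by metis
    ultimately show ?thesis
      using b(1) by blast
  qed
  then have "\<forall>d \<in> Field omega1. \<exists>b. b \<in> Field omega1 \<and> f (p d) \<in> ?D b \<and>
      (\<forall>q \<in> ?X. f q = p d \<longrightarrow> q \<in> ?D b)"
    by blast
  then obtain h where "\<forall>d \<in> Field omega1. h d \<in> Field omega1 \<and> f (p d) \<in> ?D (h d) \<and>
      (\<forall>q \<in> ?X. f q = p d \<longrightarrow> q \<in> ?D (h d))"
    by (rule bchoice[THEN exE])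
  then have h: "\<And>d. d \<in> Field omega1 \<Longrightarrow> h d \<in> Field omega1"
    "\<And>d. d \<in> Field omega1 \<Longrightarrow> f (p d) \<in> ?D (h d)"
    "\<And>d q. d \<in> Field omega1 \<Longrightarrow> q \<in> ?X \<Longrightarrow> f q = p d \<Longrightarrow> q \<in> ?D (h d)"
    by simp_all
  obtain l g where l: "l \<in> Field omega1" "(c, l) \<in> omega1 - Id"
    and gl: "\<forall>n::nat. g n \<in> Field omega1 \<and> (g n, l) \<in> omega1 - Id \<and>
      (h (g n), g (Suc n)) \<in> omega1 - Id"
    and lim: "\<forall>x. (x, l) \<in> omega1 - Id \<longrightarrow> (\<exists>n. (x, g n) \<in> omega1 - Id)"
    using omega1_closure_point[of h c, OF h(1) c] by blast
  have g: "g n \<in> Field omega1" "(g n, l) \<in> omega1 - Id" "(h (g n), g (Suc n)) \<in> omega1 - Id" for n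
    using gl by auto
  have snoc_limit: "\<exists>n. x \<in> ?D (g n)" if "x \<in> ?D l" for x
    using that l(1) g(1) lim by (intro strictly_below_snoc_limit) auto
  have up: "x \<in> ?D l" if "x \<in> ?D (h (g n))" for x n
    using strictly_below_snoc_mono[OF strictly_below_snoc_mono[OF that g(3)] g(2)] .
  \<comment> \<open>By continuity the point lies below some \<open>p (g n)\<close>; monotonicity
    carries this to the image or preimage, below cut \<open>h (g n)\<close> and hence below cut
    \<open>l\<close>.\<close>
  have "f x \<in> ?D l \<longleftrightarrow> x \<in> ?D l" if x: "x \<in> ?X" for x
  proof
    assume "x \<in> ?D l"
    then obtain n where "x \<in> ?D (g n)"
      using snoc_limit by blast
    then have "(f x, f (p (g n))) \<in> lex_omega R"
      using below_p g(1) mono x p by blast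
    then have "f x \<in> ?D (h (g n))"
      using strictly_below_down_closed[OF lin] h(2) g(1) by blast
    then show "f x \<in> ?D l"
      by (rule up)
  next
    assume "f x \<in> ?D l"
    then obtain n where "f x \<in> ?D (g n)"
      using snoc_limit by blast
    then have less: "(f x, p (g n)) \<in> lex_omega R"
      using below_p g(1) by blast
    obtain q where q: "q \<in> ?X" "f q = p (g n)"
      using bij_betw_imp_surj_on[OF bij] p[OF g(1)] by (metis imageE)
    have "(x, q) \<in> lex_omega R"
      using less q mono x by metis
    then have "x \<in> ?D (h (g n))"
      using strictly_below_down_closed[OF lin] h(3)[OF g(1) q] by blast
    then show "x \<in> ?D l"
      by (rule up)
  qed
  then show ?thesis
    using that l unfolding invariant_on_def by blast
qed

end

section \<open>The order \<open>\<omega>\<^sub>1\<^sup>* + \<omega>\<^sub>1\<close>\<close>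

lemma order_sum_simps [simp]:
  "(Inl x, Inl y) \<in> order_sum R S \<longleftrightarrow> (x, y) \<in> R"
  "(Inr x', Inr y') \<in> order_sum R S \<longleftrightarrow> (x', y') \<in> S"
  "(Inl x, Inr y') \<in> order_sum R S \<longleftrightarrow> x \<in> Field R \<and> y' \<in> Field S"
  "(Inr x', Inl y) \<notin> order_sum R S"
  unfolding order_sum_def by auto

lemma Field_order_sum: "Field (order_sum R S) = Inl ` Field R \<union> Inr ` Field S"
proof (intro equalityI subsetI)
  fix x assume "x \<in> Field (order_sum R S)"
  then obtain y where "(x, y) \<in> order_sum R S \<or> (y, x) \<in> order_sum R S"
    by (auto simp: Field_def)
  then show "x \<in> Inl ` Field R \<union> Inr ` Field S"
    by (cases x; cases y) (auto intro: FieldI1 FieldI2)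
next
  fix x assume "x \<in> Inl ` Field R \<union> Inr ` Field S"
  then consider a b where "x = Inl a" "(a, b) \<in> R \<or> (b, a) \<in> R"
    | a b where "x = Inr a" "(a, b) \<in> S \<or> (b, a) \<in> S"
    by (auto simp: Field_def)
  then show "x \<in> Field (order_sum R S)"
  proof cases
    case 1
    then have "(x, Inl b) \<in> order_sum R S \<or> (Inl b, x) \<in> order_sum R S"
      by simp
    then show ?thesis
      by (auto intro: FieldI1 FieldI2)
  next
    case 2
    then have "(x, Inr b) \<in> order_sum R S \<or> (Inr b, x) \<in> order_sum R S"
      by simp
    then show ?thesis
      by (auto intro: FieldI1 FieldI2)
  qed
qed

lemma Linear_order_order_sum:
  assumes "Linear_order R" "Linear_order S"
  shows "Linear_order (order_sum R S)"
proof -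
  note d = assms[unfolded order_on_defs]
  have "refl_on (Field (order_sum R S)) (order_sum R S)"
    using d by (auto simp: refl_on_def Field_order_sum)
  moreover have "order_sum R S \<subseteq> Field (order_sum R S) \<times> Field (order_sum R S)"
    by (auto intro: FieldI1 FieldI2)
  moreover have "trans (order_sum R S)"
  proof (rule transI)
    fix x y z assume "(x, y) \<in> order_sum R S" "(y, z) \<in> order_sum R S"
    then show "(x, z) \<in> order_sum R S"
      using d by (cases x; cases y; cases z) (auto dest: transD intro: FieldI1 FieldI2)
  qed
  moreover have "antisym (order_sum R S)"
  proof (rule antisymI)
    fix x y assume "(x, y) \<in> order_sum R S" "(y, x) \<in> order_sum R S"
    then show "x = y"
      using d by (cases x; cases y) (auto dest: antisymD)
  qed
  moreover have "total_on (Field (order_sum R S)) (order_sum R S)"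
    using d unfolding total_on_def Field_order_sum by auto blast+
  ultimately show ?thesis
    by (simp add: order_on_defs)
qed

lemma Linear_order_omega1: "Linear_order omega1"
  using Well_order_omega1 by (simp add: well_order_on_def)

abbreviation omega1_two_sided :: "(nat set + nat set) rel" where
  "omega1_two_sided \<equiv> order_sum (omega1\<inverse>) omega1"

lemma Linear_order_omega1_two_sided: "Linear_order omega1_two_sided"
  using Linear_order_omega1 by (intro Linear_order_order_sum) auto

lemma omega1_nonempty: "Field omega1 \<noteq> {}"
  using Cinfinite_omega1 by (auto simp: cinfinite_def)

interpretation upper: omega1_ended omega1_two_sided Inr
proof
  show "Linear_order omega1_two_sided"
    by (rule Linear_order_omega1_two_sided)
next
  fix x c assume "(x, Inr c) \<in> omega1_two_sided - Id" "c \<in> Field omega1"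
  then show "(\<exists>d. (d, c) \<in> omega1 - Id \<and> x = Inr d) \<or>
      (\<forall>d \<in> Field omega1. (x, Inr d) \<in> omega1_two_sided - Id)"
    by (cases x) auto
next
  fix x assume "x \<in> Field omega1_two_sided"
  then consider y where "y \<in> Field omega1" "x = Inr y" | y where "y \<in> Field omega1" "x = Inl y"
    by (auto simp: Field_order_sum)
  then show "\<exists>c \<in> Field omega1. (x, Inr c) \<in> omega1_two_sided - Id"
  proof cases
    case 1
    obtain c where "c \<in> Field omega1" "(y, c) \<in> omega1 - Id"
      using omega1_no_max[OF 1(1)] .
    with 1(2) show ?thesis
      by (intro bexI[of _ c]) auto
  next
    case 2
    then show ?thesis
      by (intro bexI[of _ y]) simp_all
  qed
qed (simp_all add: Field_order_sum)

interpretation lower: omega1_ended "omega1_two_sided\<inverse>" Inl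
proof
  show "Linear_order (omega1_two_sided\<inverse>)"
    using Linear_order_omega1_two_sided by simp
next
  fix x c assume "(x, Inl c) \<in> omega1_two_sided\<inverse> - Id" "c \<in> Field omega1"
  then show "(\<exists>d. (d, c) \<in> omega1 - Id \<and> x = Inl d) \<or>
      (\<forall>d \<in> Field omega1. (x, Inl d) \<in> omega1_two_sided\<inverse> - Id)"
    by (cases x) auto
next
  fix x assume "x \<in> Field (omega1_two_sided\<inverse>)"
  then consider y where "y \<in> Field omega1" "x = Inl y" | y where "y \<in> Field omega1" "x = Inr y"
    by (auto simp: Field_order_sum)
  then show "\<exists>c \<in> Field omega1. (x, Inl c) \<in> omega1_two_sided\<inverse> - Id"
  proof cases
    case 1
    obtain c where "c \<in> Field omega1" "(y, c) \<in> omega1 - Id"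
      using omega1_no_max[OF 1(1)] .
    with 1(2) show ?thesis
      by (intro bexI[of _ c]) auto
  next
    case 2
    then show ?thesis
      by (intro bexI[of _ y]) simp_all
  qed
qed (simp_all add: Field_order_sum)

section \<open>A fixed sequence with distinct letters\<close>

lemma omega1_sequence_inj:
  assumes "\<And>n::nat. (c n, c (Suc n)) \<in> omega1 - Id"
  shows "inj c"
proof -
  have less: "(c m, c (Suc (m + k))) \<in> omega1 - Id" for m k
  proof (induction k)
    case (Suc k)
    then show ?case
      using omega1_less_trans[of "c m" "c (Suc (m + k))"] assms[of "Suc (m + k)"] by simp
  qed (use assms in simp)
  have "c m \<noteq> c n" if "m < n" for m n
    using less[of m "n - Suc m"] that by auto
  then show ?thesis
    by (metis injI linorder_neqE_nat)
qed

lemma automorphism_fixes_injective_stream: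
  assumes f: "order_automorphism (lex_omega omega1_two_sided) f"
  obtains u where "u \<in> streams (Field omega1_two_sided)" "f u = u" "inj (\<lambda>n. u !! n)"
proof -
  let ?A = omega1_two_sided
  let ?X = "streams (Field ?A)"
  \<comment> \<open>Even lengths control the cut above the interval, odd lengths the cut below;
    appending \<open>?e n l\<close> passes from one to the other.\<close>
  let ?inv = "\<lambda>n r. invariant_on ?X f (strictly_below (if even n then ?A\<inverse> else ?A) r)"
  let ?e = "\<lambda>n::nat. if even n then Inr else Inl"
  have f': "order_automorphism (lex_omega (?A\<inverse>)) f"
    using f by (simp add: lex_omega_converse order_automorphism_converse)
  obtain c0 where c0: "c0 \<in> Field omega1"
    using omega1_nonempty by blast
  \<comment> \<open>The state pairs the prefix with its latest index, so that the next index can be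
    chosen larger.\<close>
  let ?P = "\<lambda>n (r, c). c \<in> Field omega1 \<and> r \<in> lists (Field ?A) \<and> length r = n \<and> ?inv n r"
  let ?Q = "\<lambda>n (r, c) (r', c'). (c, c') \<in> omega1 - Id \<and> r' = r @ [?e n c']"
  have "\<exists>s. \<forall>n. ?P n (s n) \<and> ?Q n (s n) (s (Suc n))"
  proof (rule dependent_nat_choice)
    \<comment> \<open>No sequence lies above the interval of the empty word, so the invariance is
      trivial.\<close>
    show "\<exists>s. ?P 0 s"
      using c0 by (auto simp: invariant_on_def strictly_below_def intro!: exI[of _ "[]"])
  next
    fix s n assume "?P n s"
    moreover obtain r c where s: "s = (r, c)"
      by fastforce
    ultimately have c: "c \<in> Field omega1" and r: "r \<in> lists (Field ?A)" "length r = n"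
      and inv: "?inv n r"
      by auto
    have "\<exists>l. l \<in> Field omega1 \<and> (c, l) \<in> omega1 - Id \<and> ?inv (Suc n) (r @ [?e n l])"
    proof (cases "even n")
      case True
      then have "invariant_on ?X f (strictly_below (?A\<inverse>) r)"
        using inv by simp
      then obtain l where "l \<in> Field omega1" "(c, l) \<in> omega1 - Id"
        "invariant_on ?X f (strictly_below ?A (r @ [Inr l]))"
        using upper.invariant_snoc[OF f r(1) _ c] by metis
      then show ?thesis
        using True by (intro exI[of _ l]) simp
    next
      case False
      then have "invariant_on (streams (Field (?A\<inverse>))) f (strictly_below ((?A\<inverse>)\<inverse>) r)"
        using inv by simp
      moreover have "r \<in> lists (Field (?A\<inverse>))"
        using r(1) by simp
      ultimately obtain l where "l \<in> Field omega1" "(c, l) \<in> omega1 - Id"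
        "invariant_on (streams (Field (?A\<inverse>))) f (strictly_below (?A\<inverse>) (r @ [Inl l]))"
        using lower.invariant_snoc[OF f' _ _ c] by metis
      then show ?thesis
        using False by (intro exI[of _ l]) simp
    qed
    then obtain l where l: "l \<in> Field omega1" "(c, l) \<in> omega1 - Id"
      "?inv (Suc n) (r @ [?e n l])"
      by blast
    have "?e n l \<in> Field ?A"
      using l(1) by (auto simp: Field_order_sum)
    then show "\<exists>s'. ?P (Suc n) s' \<and> ?Q n s s'"
      using l r s by (intro exI[of _ "(r @ [?e n l], l)"]) auto
  qed
  then obtain s where s: "\<forall>n. ?P n (s n) \<and> ?Q n (s n) (s (Suc n))" ..
  define r where "r n = fst (s n)" for n
  define c where "c n = snd (s n)" for n
  have c: "(c n, c (Suc n)) \<in> omega1 - Id" "c n \<in> Field omega1"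
    and r: "length (r n) = n" "?inv n (r n)" "r (Suc n) = r n @ [?e n (c (Suc n))]" for n
    using spec[OF s, of n] unfolding r_def c_def by (auto split: prod.splits)
  \<comment> \<open>The common limit of the prefixes \<open>r n\<close>. Letter \<open>n\<close> is
    chosen in passing to stage \<open>n + 1\<close>, hence the index \<open>Suc n\<close>.\<close>
  define u where "u = smap (\<lambda>n. ?e n (c (Suc n))) nats"
  have u_nth: "u !! n = ?e n (c (Suc n))" for n
    unfolding u_def by simp
  have r_nth: "r n ! i = u !! i" if "i < n" for i n
    using that
  proof (induction n)
    case (Suc n)
    then show ?case
      using r(1)[of n] r(3)[of n] u_nth[of n] by (cases "i = n") (auto simp: nth_append)
  qed simp
  have u: "u \<in> ?X"
    using c(2) by (auto simp: streams_iff_snth u_nth Field_order_sum)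
  have fu: "f u \<in> ?X"
    using f u unfolding order_automorphism_def Field_lex_omega by (blast dest: bij_betwE)
  have "f u = u"
  proof (rule ccontr)
    assume "f u \<noteq> u"
    then have "\<exists>n. f u !! n \<noteq> u !! n"
      using stream_smap_nats[of "f u"] stream_smap_nats[of u] by (metis ext)
    then obtain n where n: "f u !! n \<noteq> u !! n" "\<And>j. j < n \<Longrightarrow> f u !! j = u !! j"
      using exists_least_iff[of "\<lambda>n. f u !! n \<noteq> u !! n"] by auto
    have "f u !! n \<in> Field ?A" "u !! n \<in> Field ?A"
      using u fu by (auto simp: streams_iff_snth)
    then have "(f u !! n, u !! n) \<in> ?A \<or> (f u !! n, u !! n) \<in> ?A\<inverse>"
      using n(1) Linear_order_omega1_two_sided unfolding order_on_defs total_on_def by blast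
    \<comment> \<open>A longer prefix is taken, of the parity whose controlled side contains
      \<open>f u\<close>: odd if \<open>f u\<close> branches off below \<open>u\<close>, even if
      above.\<close>
    then obtain m where m: "n < m"
      "(f u !! n, u !! n) \<in> (if even m then ?A\<inverse> else ?A)"
    proof
      assume "(f u !! n, u !! n) \<in> ?A"
      then show thesis by (intro that[of "2 * n + 1"]) auto
    next
      assume "(f u !! n, u !! n) \<in> ?A\<inverse>"
      then show thesis by (intro that[of "2 * n + 2"]) auto
    qed
    let ?B = "strictly_below (if even m then ?A\<inverse> else ?A) (r m)"
    have "f u \<in> ?B"
      using fu m n r(1)[of m] r_nth[of _ m] unfolding strictly_below_def
      by (auto intro!: exI[of _ n])
    \<comment> \<open>Invariance pulls membership back from \<open>f u\<close> to \<open>u\<close>,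
      but \<open>u\<close> has prefix \<open>r m\<close>.\<close>
    then have "u \<in> ?B"
      using r(2)[of m] u unfolding invariant_on_def by blast
    then show False
      using r(1)[of m] r_nth[of _ m] unfolding strictly_below_def by auto
  qed
  moreover have "inj (\<lambda>n. u !! n)"
  proof (rule injI)
    fix m n assume "u !! m = u !! n"
    \<comment> \<open>Equal letters lie in the same summand, so their indices agree.\<close>
    then have "c (Suc m) = c (Suc n)"
      unfolding u_nth by (auto split: if_splits)
    then show "m = n"
      using injD[OF omega1_sequence_inj[of c]] c(1) by blast
  qed
  ultimately show ?thesis
    using that u by blast
qed

text \<open>A common tail reached after \<open>r\<close> in \<open>u\<close> and after
  \<open>s\<close> in \<open>a ## u\<close> starts one place earlier in \<open>u\<close> for the
  second reading. Distinct letters force \<open>length s = length r + 1\<close>, against equal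
  parity.\<close>

lemma not_sim2_Cons_of_inj:
  assumes "inj (\<lambda>n. u !! n)"
  shows "\<not> sim2 X u (a ## u)"
proof
  assume "sim2 X u (a ## u)"
  then obtain r s v where *: "length r mod 2 = length s mod 2" "u = r @- v" "a ## u = s @- v"
    unfolding sim2_def by blast
  \<comment> \<open>Entry 1 of the tail is compared, not entry 0, which would be \<open>a\<close>
    itself when \<open>s\<close> is empty.\<close>
  have "u !! (length r + 1) = v !! 1"
    using shift_snth_ge[of r "length r + 1" v] *(2) by simp
  also have "\<dots> = (a ## u) !! (length s + 1)"
    using shift_snth_ge[of s "length s + 1" v] *(3) by simp
  also have "\<dots> = u !! length s"
    by simp
  finally have "length r + 1 = length s"
    by (rule injD[OF assms])
  with *(1) show False
    by presburger
qed

theorem theorem6p1: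
  "\<not> (\<exists>f. parity_reversing_automorphism (order_sum (omega1\<inverse>) omega1) f)"
proof
  assume "\<exists>f. parity_reversing_automorphism omega1_two_sided f"
  then obtain f where f: "order_automorphism (lex_omega omega1_two_sided) f"
    "\<And>u a. u \<in> streams (Field omega1_two_sided) \<Longrightarrow> a \<in> Field omega1_two_sided \<Longrightarrow>
      sim2 (Field omega1_two_sided) (f u) (a ## u)"
    unfolding parity_reversing_automorphism_def by blast
  obtain u where u: "u \<in> streams (Field omega1_two_sided)" "f u = u" "inj (\<lambda>n. u !! n)"
    using automorphism_fixes_injective_stream[OF f(1)] .
  \<comment> \<open>The first letter of \<open>u\<close> serves as the letter \<open>a\<close> to
    prepend.\<close>
  have "u !! 0 \<in> Field omega1_two_sided"
    using u(1) unfolding streams_iff_snth by blast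
  with f(2)[OF u(1) this] u(2) not_sim2_Cons_of_inj[OF u(3)] show False
    by simp
qed

end
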